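(* Let $A$ be a uniform algebra on a compact Hausdorff space $X$ and let $S$ be the Šilov boundary for $A$. Then the restriction $A|S=\{f|_S : f\in A\}$ is a $C$-rich $\mathbb{C}$-linear subspace of $C(S,\mathbb{C})$.
   Context: $C(X,\mathbb{K})$ ($\mathbb{K}=\mathbb{R}$ or $\mathbb{C}$) is the Banach space of all $\mathbb{K}$-valued continuous functions on the compact Hausdorff space $X$ with the supremum norm. A uniform algebra on $X$ is a (uniformly) closed subalgebra of $C(X,\mathbb{C})$ which contains the constants and separates the points of $X$. A subset $L\subset X$ is a boundary for $A$ if for each $f\in A$ there is $x\in L$ with $|f(x)|=\|f\|_\infty$; the Šilov boundary for $A$ is the smallest closed boundary, i.e. a closed boundary contained in every closed boundary for $A$ (it exists for a uniform algebra). A closed $\mathbb{K}$-linear subspace $E$ of $C(K,\mathbb{K})$ ($K$ compact Hausdorff) is called $C$-rich if for every nonempty open subset $U$ of $K$ and every $\varepsilon>0$ there exists a positive (i.e. $\ge 0$ everywhere) function $h_\varepsilon\in C(K,\mathbb{R})$ of norm $1$ with support inside $U$ such that the distance from $h_\varepsilon$ to $E$ is less than $\varepsilon$. *)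

theory Defs
  imports "HOL-Analysis.Analysis"
begin

text \<open>
  A compact Hausdorff space is a value \<open>X :: 'a topology\<close>, so that closed subsets are again
  spaces (as subtopologies).  The metric space \<open>cfunspace X euclidean_metric\<close> has as points the
  continuous functions that are extensional on \<open>topspace X\<close> (boundedness being automatic for
  compact \<open>X\<close>), and as metric the supremum distance. Being extensional makes functions equal as
  soon as they agree on the space; algebraic operations are therefore restricted to the space.
  The scalar class \<open>real_normed_field\<close> has both \<open>real\<close> and \<open>complex\<close> as instances.
\<close>

abbreviation C_space :: "'a topology \<Rightarrow> ('a \<Rightarrow> 'k::real_normed_field) metric"
  where "C_space X \<equiv> cfunspace X euclidean_metric"

text \<open>On an empty space the supremum is meaningless, but there no boundary exists and
  the condition of being C-rich involves no function.\<close>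

definition sup_norm :: "'a topology \<Rightarrow> ('a \<Rightarrow> 'k::real_normed_field) \<Rightarrow> real"
  where "sup_norm X f = (SUP x\<in>topspace X. norm (f x))"

definition closed_linear_subspace ::
  "'a topology \<Rightarrow> ('a \<Rightarrow> 'k::real_normed_field) set \<Rightarrow> bool"
  where "closed_linear_subspace X E \<longleftrightarrow>
    closedin (mtopology_of (C_space X)) E \<and>
    (\<lambda>x\<in>topspace X. 0) \<in> E \<and>
    (\<forall>f\<in>E. \<forall>g\<in>E. (\<lambda>x\<in>topspace X. f x + g x) \<in> E) \<and>
    (\<forall>c. \<forall>f\<in>E. (\<lambda>x\<in>topspace X. c * f x) \<in> E)"

definition uniform_algebra :: "'a topology \<Rightarrow> ('a \<Rightarrow> complex) set \<Rightarrow> bool"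
  where "uniform_algebra X A \<longleftrightarrow>
    closed_linear_subspace X A \<and>
    (\<forall>f\<in>A. \<forall>g\<in>A. (\<lambda>x\<in>topspace X. f x * g x) \<in> A) \<and>
    (\<forall>c. (\<lambda>x\<in>topspace X. c) \<in> A) \<and>
    (\<forall>x\<in>topspace X. \<forall>y\<in>topspace X. x \<noteq> y \<longrightarrow> (\<exists>f\<in>A. f x \<noteq> f y))"

definition boundary_for :: "'a topology \<Rightarrow> ('a \<Rightarrow> complex) set \<Rightarrow> 'a set \<Rightarrow> bool"
  where "boundary_for X A L \<longleftrightarrow>
    L \<subseteq> topspace X \<and> (\<forall>f\<in>A. \<exists>x\<in>L. norm (f x) = sup_norm X f)"

definition is_Shilov_boundary :: "'a topology \<Rightarrow> ('a \<Rightarrow> complex) set \<Rightarrow> 'a set \<Rightarrow> bool"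
  where "is_Shilov_boundary X A S \<longleftrightarrow>
    closedin X S \<and> boundary_for X A S \<and>
    (\<forall>L. closedin X L \<and> boundary_for X A L \<longrightarrow> S \<subseteq> L)"

definition C_rich :: "'a topology \<Rightarrow> ('a \<Rightarrow> 'k::real_normed_field) set \<Rightarrow> bool"
  where "C_rich K E \<longleftrightarrow>
    compact_space K \<and> Hausdorff_space K \<and> closed_linear_subspace K E \<and>
    (\<forall>U \<epsilon>. openin K U \<and> U \<noteq> {} \<and> \<epsilon> > 0 \<longrightarrow>
      (\<exists>h :: 'a \<Rightarrow> real.
        h \<in> mspace (C_space K) \<and>
        (\<forall>x\<in>topspace K. h x \<ge> 0) \<and>
        sup_norm K h = 1 \<and>
        K closure_of {x\<in>topspace K. h x \<noteq> 0} \<subseteq> U \<and>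
        (INF g\<in>E. mdist (C_space K) (\<lambda>x\<in>topspace K. of_real (h x)) g) < \<epsilon>))"

end

theory Submission
  imports Defs
begin

text \<open>
  Since \<open>S\<close> lies in every closed boundary, a nonempty relatively open \<open>U \<subseteq> S\<close> cannot be
  removed from it: the smaller closed set \<open>S - U\<close> is not a boundary, so some \<open>f \<in> A\<close> attains its
  norm on \<open>U\<close> but, by compactness, stays uniformly below it on \<open>S - U\<close>. After rescaling and
  taking a high power, \<open>f\<close> has value \<open>1\<close> at a point of \<open>U\<close>, maps \<open>S\<close> into the closed unit disc
  and is as small as desired on \<open>S - U\<close> (\<open>Shilov_boundary_peaking\<close>).

  The values of \<open>f\<close> on \<open>U\<close> are still arbitrary complex numbers in the disc, whereas a function
  close to a nonnegative one is wanted. This is repaired by composing with a polynomial that fixes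
  \<open>0\<close> and \<open>1\<close> and squeezes the disc into a thin neighbourhood of the interval \<open>[0, 1]\<close>
  (\<open>thin_polynomial\<close>). Such a polynomial is explicit. For \<open>r < 1\<close> close to \<open>1\<close> the function
  \<open>- Ln (1 - r z)\<close> has on the disc imaginary part between \<open>- pi / 2\<close> and \<open>pi / 2\<close> and real part at
  least \<open>- ln 2\<close>, while its value \<open>- ln (1 - r)\<close> at \<open>1\<close> is huge; so, divided by that value, it is
  almost real and almost nonnegative. Its power series at \<open>0\<close> converges uniformly on the disc and
  has nonnegative coefficients, so a normalised partial sum does the job, and the triangle
  inequality shows that this partial sum moreover maps the disc into itself.

  The resulting \<open>g \<in> A\<close> is within \<open>2 * \<eta>\<close> of the function \<open>h\<close> obtained from its real part by
  cutting off at height \<open>\<eta>\<close> and rescaling to maximum \<open>1\<close>; the cut-off moves the support of \<open>h\<close>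
  into \<open>U\<close>.

  It remains that the restrictions to \<open>S\<close> form a closed subspace of the continuous functions on
  \<open>S\<close> (\<open>closed_linear_subspace_restrict\<close>): as \<open>S\<close> is a boundary, restriction is an isometry on
  \<open>A\<close>, and the isometric image of a complete space is complete, hence closed.
\<close>

section \<open>Polynomials that squeeze the unit disc\<close>

text \<open>
  The polynomial is a partial sum of \<open>- Ln (1 - r z) = (\<Sum>n. (r z) ^ n / n)\<close>, divided by its
  value at \<open>1\<close>. On the disc, \<open>1 - r z\<close> has positive real part and norm at most \<open>2\<close>, which bounds
  the imaginary part of the series in absolute value and its real part from below, both
  independently of \<open>r\<close>; but the value at \<open>1\<close> tends to infinity as \<open>r\<close> tends to \<open>1\<close>.
\<close>

lemma thin_polynomial:
  fixes \<epsilon> :: real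
  assumes "\<epsilon> > 0"
  obtains N :: nat and a :: "nat \<Rightarrow> real"
  where "a 0 = 0" and "\<And>n. a n \<ge> 0" and "(\<Sum>n<N. a n) = 1"
    and "\<And>z. norm z \<le> 1 \<Longrightarrow> Re (\<Sum>n<N. complex_of_real (a n) * z ^ n) \<ge> - \<epsilon>"
    and "\<And>z. norm z \<le> 1 \<Longrightarrow> \<bar>Im (\<Sum>n<N. complex_of_real (a n) * z ^ n)\<bar> \<le> \<epsilon>"
proof -
  \<comment> \<open>\<open>L = - ln (1 - r)\<close> is the value at \<open>1\<close>. The partial sum is taken within \<open>1\<close> of the full
    series, so its imaginary part is at most \<open>pi / 2 + 1 \<le> 3\<close>, its real part at least
    \<open>- ln 2 - 1 \<ge> - 2\<close>, and its value at \<open>1\<close> at least \<open>L - 1\<close>.\<close>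
  define L where "L = 3 / \<epsilon> + 1"
  define r where "r = 1 - exp (- L)"
  have "L > 0"
    using assms by (simp add: L_def add_pos_pos)
  then have r: "0 < r" "r < 1"
    by (auto simp: r_def)
  \<comment> \<open>Division by \<open>0\<close> gives the constant term the desired value \<open>0\<close>.\<close>
  define b where "b n = r ^ n / real n" for n
  have b0: "b 0 = 0" and bnn: "b n \<ge> 0" for n
    using r by (auto simp: b_def)
  have "(\<lambda>n. - ((- (- r)) ^ n) / of_nat n) sums ln (1 + (- r))"
    using ln_series' [of "- r"] r by simp
  then have "(\<lambda>n. - b n) sums (- L)"
    by (simp add: r_def b_def)
  then have b_sums: "b sums L"
    using sums_minus by fastforce
  have "(\<lambda>N. sum b {..<N}) \<longlonglongrightarrow> L"
    using b_sums by (simp add: sums_def)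
  then have "\<forall>\<^sub>F N in sequentially. sum b {..<N} > L - 1"
    by (rule order_tendstoD) simp
  then obtain N where N: "sum b {..<N} > L - 1"
    by (auto simp: eventually_sequentially)
  define s where "s = sum b {..<N}"
  have s: "s > 0" "3 / s \<le> \<epsilon>" "2 / s \<le> \<epsilon>"
  proof -
    have "3 / \<epsilon> < s"
      using N by (simp add: s_def L_def)
    moreover have "3 / \<epsilon> > 0"
      using assms by simp
    ultimately show "s > 0" by linarith
    with \<open>3 / \<epsilon> < s\<close> assms show "3 / s \<le> \<epsilon>"
      by (simp add: field_simps)
    moreover have "2 / s \<le> 3 / s"
      using \<open>s > 0\<close> by (simp add: divide_right_mono)
    ultimately show "2 / s \<le> \<epsilon>" by linarith
  qed
  \<comment> \<open>The coefficients are nonnegative, so on the disc the tail is largest at \<open>z = 1\<close>.\<close>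
  have approx: "norm ((\<Sum>n<N. complex_of_real (b n) * z ^ n) + Ln (1 - of_real r * z)) \<le> 1"
    if "norm z \<le> 1" for z
  proof -
    let ?f = "\<lambda>n. complex_of_real (b n) * z ^ n"
    have "r * norm z < 1"
      using r that by (smt (verit) mult_left_le)
    then have "(\<lambda>n. - ((- (- (of_real r * z))) ^ n) / of_nat n) sums ln (1 + (- (of_real r * z)))"
      using r by (intro Ln_series') (simp add: norm_mult)
    then have "(\<lambda>n. - ?f n) sums Ln (1 - of_real r * z)"
      by (simp add: b_def power_mult_distrib)
    then have f: "?f sums (- Ln (1 - of_real r * z))"
      using sums_minus by fastforce
    have tail: "(\<lambda>n. ?f (n + N)) sums (- Ln (1 - of_real r * z) - sum ?f {..<N})"
      using f by (rule sums_split_initial_segment)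
    have btail: "(\<lambda>n. b (n + N)) sums (L - s)"
      unfolding s_def using b_sums by (rule sums_split_initial_segment)
    have "norm (?f n) \<le> b n" for n
      using bnn[of n] that by (simp add: norm_mult norm_power mult_left_le power_le_one)
    then have "norm (\<Sum>n. ?f (n + N)) \<le> (\<Sum>n. b (n + N))"
      using btail by (intro norm_suminf_le) (auto simp: sums_iff)
    then have "norm (- Ln (1 - of_real r * z) - sum ?f {..<N}) \<le> L - s"
      using tail btail by (simp add: sums_iff)
    also have "\<dots> \<le> 1"
      using N by (simp add: s_def)
    finally show ?thesis
      by (simp add: norm_minus_commute add.commute flip: norm_minus_cancel[of "_ + _"])
  qed
  define a where "a n = b n / s" for n
  have a_sum: "(\<Sum>n<N. complex_of_real (a n) * z ^ n) = (\<Sum>n<N. complex_of_real (b n) * z ^ n) / of_real s" for z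
    by (simp add: a_def sum_divide_distrib)
  have Re_pos: "Re (1 - of_real r * z) > 0" and norm_le: "norm (1 - of_real r * z) \<le> 2"
    if "norm z \<le> 1" for z
  proof -
    have *: "norm (of_real r * z) < 1"
      using r that by (smt (verit) mult_left_le norm_mult norm_of_real norm_ge_zero)
    then show "Re (1 - of_real r * z) > 0"
      using complex_Re_le_cmod[of "of_real r * z"] by simp
    show "norm (1 - of_real r * z) \<le> 2"
      using * norm_triangle_ineq4[of 1 "of_real r * z"] by simp
  qed
  show thesis
  proof
    show "a 0 = 0"
      by (simp add: a_def b0)
    show "a n \<ge> 0" for n
      using bnn[of n] s by (simp add: a_def)
    show "(\<Sum>n<N. a n) = 1"
      using s by (simp add: a_def s_def flip: sum_divide_distrib)
  next
    fix z :: complex assume z: "norm z \<le> 1"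
    let ?p = "\<Sum>n<N. complex_of_real (b n) * z ^ n" and ?w = "1 - of_real r * z"
    have w: "?w \<noteq> 0"
      using Re_pos[OF z] by force
    have "ln (norm ?w) \<le> ln 2"
      using w norm_le[OF z] by (intro ln_mono) auto
    also have "\<dots> \<le> 1"
      using ln_2_less_1 by simp
    finally have "Re (Ln ?w) \<le> 1"
      using w by simp
    moreover have "\<bar>Re (?p + Ln ?w)\<bar> \<le> 1"
      using approx[OF z] abs_Re_le_cmod order_trans by blast
    ultimately have "Re ?p \<ge> - 2"
      by (simp only: plus_complex.sel)
    then have "Re ?p / s \<ge> - 2 / s"
      using s(1) by (intro divide_right_mono) auto
    then show "Re (\<Sum>n<N. complex_of_real (a n) * z ^ n) \<ge> - \<epsilon>"
      unfolding a_sum Re_divide_of_real using s(3) by simp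
    have "\<bar>Im (Ln ?w)\<bar> < pi / 2"
      by (rule Re_Ln_pos_lt_imp[OF Re_pos[OF z]])
    moreover have "\<bar>Im (?p + Ln ?w)\<bar> \<le> 1"
      using approx[OF z] abs_Im_le_cmod order_trans by blast
    ultimately have "\<bar>Im ?p\<bar> \<le> 3"
      using pi_less_4 by (simp only: plus_complex.sel)
    then have "\<bar>Im ?p\<bar> / s \<le> 3 / s"
      using s(1) by (intro divide_right_mono) auto
    then show "\<bar>Im (\<Sum>n<N. complex_of_real (a n) * z ^ n)\<bar> \<le> \<epsilon>"
      unfolding a_sum Im_divide_of_real using s by simp
  qed
qed

section \<open>Spaces of continuous functions on a compact space\<close>

lemma mspace_C_space:
  assumes "compact_space X"
  shows "f \<in> mspace (C_space X) \<longleftrightarrow>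
    f \<in> extensional (topspace X) \<and> continuous_map X euclidean f"
  using assms by (simp add: compactin_mspace_cfunspace compact_space_def del: mspace_cfunspace)

lemma norm_le_sup_norm:
  assumes "compact_space X" and "continuous_map X euclidean f" and "x \<in> topspace X"
  shows "norm (f x) \<le> sup_norm X f"
proof -
  have "compactin euclidean (f ` topspace X)"
    using assms by (intro image_compactin) (auto simp: compact_space_def)
  then have "bounded (f ` topspace X)"
    by (simp add: compact_imp_bounded)
  then have "bdd_above ((\<lambda>x. norm (f x)) ` topspace X)"
    by (metis bdd_above_norm image_image)
  then show ?thesis
    unfolding sup_norm_def using assms(3) by (rule cSUP_upper2) simp
qed

text \<open>
  Applied to differences of functions, this says that restriction to a boundary is isometric on a
  linear space.
\<close>

lemma norm_le_from_boundary:
  assumes "compact_space X" and "boundary_for X A S" and "f \<in> A"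
    and "continuous_map X euclidean f" and "\<And>x. x \<in> S \<Longrightarrow> norm (f x) \<le> c"
    and "x \<in> topspace X"
  shows "norm (f x) \<le> c"
proof -
  obtain y where "y \<in> S" "norm (f y) = sup_norm X f"
    using assms(2,3) by (auto simp: boundary_for_def)
  then show ?thesis
    using norm_le_sup_norm[OF assms(1,4,6)] assms(5)[of y] by simp
qed

lemma limitin_C_space:
  assumes "compact_space X"
  shows "limitin (mtopology_of (C_space X)) \<sigma> l sequentially \<longleftrightarrow>
    l \<in> mspace (C_space X) \<and>
    (\<forall>\<epsilon>>0. \<exists>N. \<forall>n\<ge>N. \<sigma> n \<in> mspace (C_space X) \<and> (\<forall>x\<in>topspace X. dist (\<sigma> n x) (l x) \<le> \<epsilon>))"
    (is "_ \<longleftrightarrow> _ \<and> ?R")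
proof -
  interpret C: Metric_space "mspace (C_space X)" "mdist (C_space X)"
    by (rule Metric_space_mspace_mdist)
  have "(\<forall>\<epsilon>>0. \<exists>N. \<forall>n\<ge>N. \<sigma> n \<in> mspace (C_space X) \<and> mdist (C_space X) (\<sigma> n) l < \<epsilon>) \<longleftrightarrow> ?R"
    if l: "l \<in> mspace (C_space X)"
  proof safe
    fix \<epsilon> :: real
    assume *: "\<forall>\<epsilon>>0. \<exists>N. \<forall>n\<ge>N. \<sigma> n \<in> mspace (C_space X) \<and> mdist (C_space X) (\<sigma> n) l < \<epsilon>"
      and "\<epsilon> > 0"
    then obtain N where "\<And>n. n \<ge> N \<Longrightarrow> \<sigma> n \<in> mspace (C_space X) \<and> mdist (C_space X) (\<sigma> n) l < \<epsilon>"
      by blast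
    then show "\<exists>N. \<forall>n\<ge>N. \<sigma> n \<in> mspace (C_space X) \<and> (\<forall>x\<in>topspace X. dist (\<sigma> n x) (l x) \<le> \<epsilon>)"
      using mdist_cfunspace_imp_mdist_le[OF _ l] by (metis mdist_euclidean_metric less_imp_le)
  next
    fix \<epsilon> :: real
    assume *: ?R and "\<epsilon> > 0"
    then have "\<epsilon> / 2 > 0" by simp
    with * obtain N where N: "\<And>n. n \<ge> N \<Longrightarrow> \<sigma> n \<in> mspace (C_space X) \<and>
        (\<forall>x\<in>topspace X. dist (\<sigma> n x) (l x) \<le> \<epsilon> / 2)"
      by blast
    have "mdist (C_space X) (\<sigma> n) l \<le> \<epsilon> / 2" if "n \<ge> N" for n
      using N[OF that] \<open>\<epsilon> > 0\<close> by (intro mdist_cfunspace_le) auto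
    then show "\<exists>N. \<forall>n\<ge>N. \<sigma> n \<in> mspace (C_space X) \<and> mdist (C_space X) (\<sigma> n) l < \<epsilon>"
      using N \<open>\<epsilon> > 0\<close> by (metis field_less_half_sum add_0 le_less_trans half_gt_zero_iff field_sum_of_halves less_add_same_cancel1)
  qed
  then show ?thesis
    unfolding mtopology_of_def C.limit_metric_sequentially by blast
qed

text \<open>
  A convergent sequence of restrictions is Cauchy on \<open>S\<close>, hence the sequence of the original
  functions is Cauchy on all of \<open>X\<close>; it converges in the closed subspace \<open>A\<close>, and the restriction
  of its limit must be the given limit.
\<close>

lemma closed_linear_subspace_restrict:
  fixes A :: "('a \<Rightarrow> complex) set"
  assumes X: "compact_space X" and SX: "closedin X S"
    and A: "closed_linear_subspace X A" and bd: "boundary_for X A S"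
  shows "closed_linear_subspace (subtopology X S) ((\<lambda>f. restrict f S) ` A)"
proof -
  let ?K = "subtopology X S" and ?E = "(\<lambda>f. restrict f S) ` A"
  have sub: "S \<subseteq> topspace X"
    using SX by (rule closedin_subset)
  then have topK: "topspace ?K = S" by auto
  have K: "compact_space ?K"
    using X SX closedin_compact_space compact_space_subtopology by blast
  interpret CX: Metric_space "mspace (C_space X :: ('a \<Rightarrow> complex) metric)" "mdist (C_space X)"
    by (rule Metric_space_mspace_mdist)
  interpret CK: Metric_space "mspace (C_space ?K :: ('a \<Rightarrow> complex) metric)" "mdist (C_space ?K)"
    by (rule Metric_space_mspace_mdist)
  have clA: "closedin CX.mtopology A"
    and A0: "(\<lambda>x\<in>topspace X. 0) \<in> A"
    and Aadd: "\<And>f g. f \<in> A \<Longrightarrow> g \<in> A \<Longrightarrow> (\<lambda>x\<in>topspace X. f x + g x) \<in> A"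
    and Ascale: "\<And>c f. f \<in> A \<Longrightarrow> (\<lambda>x\<in>topspace X. c * f x) \<in> A"
    using A by (auto simp: closed_linear_subspace_def mtopology_of_def)
  have AC: "A \<subseteq> mspace (C_space X)"
    using closedin_subset[OF clA] by (simp only: CX.topspace_mtopology)
  have cont: "continuous_map X euclidean f" if "f \<in> A" for f
    using AC that mspace_C_space[OF X] by blast
  have sub_bound: "dist (f x) (g x) \<le> c"
    if "f \<in> A" "g \<in> A" "\<And>x. x \<in> S \<Longrightarrow> dist (f x) (g x) \<le> c" "x \<in> topspace X" for f g c x
  proof -
    define h where "h = (\<lambda>x\<in>topspace X. f x + (\<lambda>x\<in>topspace X. (-1) * g x) x)"
    have h: "h \<in> A"
      unfolding h_def using that by (intro Aadd Ascale)
    have hx: "norm (h x) = dist (f x) (g x)" if "x \<in> topspace X" for x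
      using that by (simp add: h_def dist_norm)
    have "norm (h x) \<le> c"
      using norm_le_from_boundary[OF X bd h cont[OF h]] that hx sub by (metis subsetD)
    then show ?thesis
      using hx that by simp
  qed
  have EC: "?E \<subseteq> mspace (C_space ?K)"
  proof safe
    fix f assume "f \<in> A"
    then have "continuous_map ?K euclidean (restrict f S)"
      using cont[of f] by (metis continuous_map_from_subtopology continuous_map_eq restrict_apply' topK)
    then show "restrict f S \<in> mspace (C_space ?K)"
      unfolding mspace_C_space[OF K] topK by simp
  qed
  have "closedin CK.mtopology ?E"
    unfolding CK.metric_closedin_iff_sequentially_closed
  proof (intro conjI EC allI impI, elim conjE)
    fix \<sigma> l
    assume \<sigma>E: "range \<sigma> \<subseteq> ?E" and lim: "limitin CK.mtopology \<sigma> l sequentially"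
    have "\<forall>n. \<exists>F\<in>A. \<sigma> n = restrict F S"
      using \<sigma>E by blast
    then obtain F where FA: "\<And>n. F n \<in> A" and F\<sigma>: "\<And>n. \<sigma> n = restrict (F n) S"
      by metis
    have FC: "F n \<in> mspace (C_space X)" for n
      using FA AC by blast
    have l: "l \<in> mspace (C_space ?K)"
      and lim': "\<And>\<epsilon>. \<epsilon> > 0 \<Longrightarrow> \<exists>N. \<forall>n\<ge>N. \<forall>x\<in>S. dist (F n x) (l x) \<le> \<epsilon>"
      using lim unfolding limitin_C_space[OF K, of \<sigma> l, unfolded mtopology_of_def topK]
      unfolding F\<sigma> by (blast, simp del: mspace_cfunspace topspace_subtopology, meson)
    have "CX.MCauchy F"
      unfolding CX.MCauchy_def
    proof (intro conjI allI impI)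
      show "range F \<subseteq> mspace (C_space X)"
        using FC by blast
      fix \<epsilon> :: real assume "\<epsilon> > 0"
      then have "\<epsilon> / 3 > 0" by simp
      from lim'[OF this] obtain N where N: "\<And>n x. n \<ge> N \<Longrightarrow> x \<in> S \<Longrightarrow> dist (F n x) (l x) \<le> \<epsilon> / 3"
        by blast
      have "mdist (C_space X) (F n) (F m) < \<epsilon>" if "N \<le> n" "N \<le> m" for n m
      proof -
        have "dist (F n x) (F m x) \<le> 2 * \<epsilon> / 3" if "x \<in> S" for x
          using N[OF \<open>N \<le> n\<close> that] N[OF \<open>N \<le> m\<close> that] dist_triangle2[of "F n x" "F m x" "l x"] by simp
        then have "dist (F n x) (F m x) \<le> 2 * \<epsilon> / 3" if "x \<in> topspace X" for x
          using sub_bound[OF FA FA _ that] by blast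
        then have "mdist (C_space X) (F n) (F m) \<le> 2 * \<epsilon> / 3"
          using \<open>\<epsilon> > 0\<close> by (intro mdist_cfunspace_le) auto
        then show ?thesis
          using \<open>\<epsilon> > 0\<close> by simp
      qed
      then show "\<exists>N. \<forall>n n'. N \<le> n \<longrightarrow> N \<le> n' \<longrightarrow> mdist (C_space X) (F n) (F n') < \<epsilon>"
        by blast
    qed
    moreover have "CX.mcomplete"
    proof -
      have "mcomplete_of (C_space X :: ('a \<Rightarrow> complex) metric)"
        using Met_TC.mcomplete_cfunspace[where 'a=complex] complete_UNIV
        by (simp add: Met_TC.Self_def euclidean_metric_def)
      then show ?thesis
        by (simp add: mcomplete_of_def)
    qed
    ultimately obtain G where G: "limitin CX.mtopology F G sequentially"
      unfolding CX.mcomplete_def by blast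
    have GA: "G \<in> A"
      using clA FA G unfolding CX.metric_closedin_iff_sequentially_closed by blast
    have G': "\<And>\<epsilon>. \<epsilon> > 0 \<Longrightarrow> \<exists>N. \<forall>n\<ge>N. \<forall>x\<in>topspace X. dist (F n x) (G x) \<le> \<epsilon>"
      using G unfolding limitin_C_space[OF X, of F G, unfolded mtopology_of_def] by meson
    have "limitin CK.mtopology \<sigma> (restrict G S) sequentially"
      unfolding limitin_C_space[OF K, of \<sigma> "restrict G S", unfolded mtopology_of_def]
    proof (intro conjI allI impI)
      show "restrict G S \<in> mspace (C_space ?K)"
        using GA EC by blast
      fix \<epsilon> :: real assume "\<epsilon> > 0"
      then obtain N where "\<forall>n\<ge>N. \<forall>x\<in>topspace X. dist (F n x) (G x) \<le> \<epsilon>"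
        using G' by blast
      moreover have "\<sigma> n \<in> mspace (C_space ?K)" for n
        using \<sigma>E EC by blast
      ultimately show "\<exists>N. \<forall>n\<ge>N. \<sigma> n \<in> mspace (C_space ?K) \<and>
          (\<forall>x\<in>topspace ?K. dist (\<sigma> n x) (restrict G S x) \<le> \<epsilon>)"
        using sub by (auto simp: F\<sigma> topK simp del: mspace_cfunspace)
    qed
    then have "l = restrict G S"
      using lim CK.limitin_metric_unique by (metis trivial_limit_sequentially)
    then show "l \<in> ?E"
      using GA by blast
  qed
  moreover have "(\<lambda>x\<in>topspace ?K. 0) \<in> ?E"
    using sub by (intro image_eqI[OF _ A0]) (auto simp: topK)
  moreover have "(\<lambda>x\<in>topspace ?K. f x + g x) \<in> ?E" if E: "f \<in> ?E" "g \<in> ?E" for f g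
  proof -
    obtain F G where "F \<in> A" "G \<in> A" "f = restrict F S" "g = restrict G S"
      using E by blast
    then show ?thesis
      using sub by (intro image_eqI[OF _ Aadd[of F G]]) (auto simp: topK)
  qed
  moreover have "(\<lambda>x\<in>topspace ?K. c * f x) \<in> ?E" if E: "f \<in> ?E" for f c
  proof -
    obtain F where "F \<in> A" "f = restrict F S"
      using E by blast
    then show ?thesis
      using sub by (intro image_eqI[OF _ Ascale[of F c]]) (auto simp: topK)
  qed
  ultimately show ?thesis
    unfolding closed_linear_subspace_def mtopology_of_def by blast
qed

section \<open>Uniform algebras and their Shilov boundary\<close>

lemma uniform_algebra_closed_operations:
  assumes "uniform_algebra X A"
  shows uniform_algebra_const: "(\<lambda>x\<in>topspace X. c) \<in> A"
    and uniform_algebra_scale: "f \<in> A \<Longrightarrow> (\<lambda>x\<in>topspace X. c * f x) \<in> A"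
    and uniform_algebra_add: "f \<in> A \<Longrightarrow> g \<in> A \<Longrightarrow> (\<lambda>x\<in>topspace X. f x + g x) \<in> A"
    and uniform_algebra_mult: "f \<in> A \<Longrightarrow> g \<in> A \<Longrightarrow> (\<lambda>x\<in>topspace X. f x * g x) \<in> A"
  using assms by (simp_all only: uniform_algebra_def closed_linear_subspace_def)

lemma uniform_algebra_power:
  assumes "uniform_algebra X A" and "f \<in> A"
  shows "(\<lambda>x\<in>topspace X. f x ^ n) \<in> A"
proof (induction n)
  case 0
  show ?case
    unfolding power_0 by (rule uniform_algebra_const[OF assms(1)])
next
  case (Suc n)
  have "(\<lambda>x\<in>topspace X. f x ^ Suc n) = (\<lambda>x\<in>topspace X. f x * (\<lambda>x\<in>topspace X. f x ^ n) x)"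
    by (rule restrict_ext) simp
  then show ?case
    using uniform_algebra_mult[OF assms Suc] by (simp only:)
qed

lemma uniform_algebra_polynomial:
  assumes "uniform_algebra X A" and "f \<in> A"
  shows "(\<lambda>x\<in>topspace X. \<Sum>n<N. c n * f x ^ n) \<in> A"
proof (induction N)
  case 0
  show ?case
    unfolding lessThan_0 sum.empty by (rule uniform_algebra_const[OF assms(1)])
next
  case (Suc N)
  let ?s = "\<lambda>x\<in>topspace X. \<Sum>n<N. c n * f x ^ n" and ?p = "\<lambda>x\<in>topspace X. f x ^ N"
  have "(\<lambda>x\<in>topspace X. \<Sum>n<Suc N. c n * f x ^ n) =
      (\<lambda>x\<in>topspace X. ?s x + (\<lambda>x\<in>topspace X. c N * ?p x) x)"
    by (rule restrict_ext) simp
  moreover have "(\<lambda>x\<in>topspace X. c N * ?p x) \<in> A"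
    by (intro uniform_algebra_scale[OF assms(1)] uniform_algebra_power assms)
  ultimately show ?case
    using uniform_algebra_add[OF assms(1) Suc] by (simp only:)
qed

lemma uniform_algebra_continuous:
  assumes "compact_space X" and "uniform_algebra X A" and "f \<in> A"
  shows "continuous_map X euclidean f"
proof -
  have "A \<subseteq> mspace (C_space X)"
    using assms by (auto simp: uniform_algebra_def closed_linear_subspace_def closedin_def simp del: mspace_cfunspace)
  then show ?thesis
    using assms mspace_C_space by blast
qed

text \<open>
  Minimality of \<open>S\<close> yields a function of \<open>A\<close> that does not attain its norm on \<open>S - U\<close>. Compactness
  of \<open>S - U\<close> turns this into a gap, and taking powers widens the gap.
\<close>

lemma Shilov_boundary_peaking:
  assumes X: "compact_space X" and A: "uniform_algebra X A" and S: "is_Shilov_boundary X A S"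
    and U: "openin (subtopology X S) U" "U \<noteq> {}" and "\<delta> > 0"
  obtains f p where "f \<in> A" "p \<in> U" "f p = 1"
    "\<And>x. x \<in> S \<Longrightarrow> norm (f x) \<le> 1" "\<And>x. x \<in> S - U \<Longrightarrow> norm (f x) < \<delta>"
proof -
  have clS: "closedin X S" and bd: "boundary_for X A S"
    and min: "\<And>L. closedin X L \<Longrightarrow> boundary_for X A L \<Longrightarrow> S \<subseteq> L"
    using S by (auto simp: is_Shilov_boundary_def)
  have sub: "S \<subseteq> topspace X"
    using clS by (rule closedin_subset)
  have US: "U \<subseteq> S"
    using openin_subset[OF U(1)] sub by auto
  have "closedin (subtopology X S) (topspace (subtopology X S) - U)"
    using U(1) by (rule openin_closedin_eq[THEN iffD1, THEN conjunct2])
  moreover have "topspace (subtopology X S) = S"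
    using sub by auto
  ultimately have clL: "closedin X (S - U)"
    using clS closedin_trans_full by fastforce
  have "\<not> boundary_for X A (S - U)"
    using min[OF clL] US U(2) by blast
  then obtain f where f: "f \<in> A" and ne: "\<And>x. x \<in> S - U \<Longrightarrow> norm (f x) \<noteq> sup_norm X f"
    using sub by (auto simp: boundary_for_def)
  have cont: "continuous_map X euclidean f"
    using uniform_algebra_continuous[OF X A f] .
  have le: "norm (f x) \<le> sup_norm X f" if "x \<in> S" for x
    using norm_le_sup_norm[OF X cont] that sub by blast
  obtain p where "p \<in> S" and p: "norm (f p) = sup_norm X f"
    using bd f by (auto simp: boundary_for_def)
  then have pU: "p \<in> U"
    using ne by blast
  show thesis
  proof (cases "S - U = {}")
    case True
    \<comment> \<open>Here the function found may be zero, but the constant \<open>1\<close> will do.\<close>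
    have "(\<lambda>x\<in>topspace X. 1) \<in> A"
      by (rule uniform_algebra_const[OF A])
    then show thesis
      by (rule that[OF _ pU]) (use True sub pU US in auto)
  next
    case False
    have "compactin euclidean (f ` (S - U))"
      using clL X cont closedin_compact_space image_compactin by blast
    then have "compact ((\<lambda>x. norm (f x)) ` (S - U))"
      using compact_continuous_image[of "f ` (S - U)" norm] 
      by (simp add: image_image continuous_on_norm_id)
    with False obtain y where y: "y \<in> S - U" and ymax: "\<And>x. x \<in> S - U \<Longrightarrow> norm (f x) \<le> norm (f y)"
      using compact_attains_sup[of "(\<lambda>x. norm (f x)) ` (S - U)"] by auto
    have ylt: "norm (f y) < norm (f p)"
      using le[of y] ne[OF y] y p by fastforce
    then have fp: "f p \<noteq> 0"
      by auto
    define q where "q = norm (f y) / norm (f p)"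
    have "q < 1"
      using ylt by (auto simp: q_def divide_less_eq_1)
    then obtain k where k: "q ^ k < \<delta>"
      using real_arch_pow_inv \<open>\<delta> > 0\<close> by blast
    define g where "g = (\<lambda>x\<in>topspace X. (\<lambda>x\<in>topspace X. inverse (f p) * f x) x ^ k)"
    have "g \<in> A"
      unfolding g_def by (intro uniform_algebra_power[OF A] uniform_algebra_scale[OF A] f)
    moreover have g: "g x = (f x / f p) ^ k" if "x \<in> S" for x
      using that sub by (auto simp: g_def field_simps)
    have "g p = 1"
      using g[OF \<open>p \<in> S\<close>] fp by simp
    moreover have "norm (g x) \<le> 1" if "x \<in> S" for x
      using le[OF that] fp unfolding g[OF that] norm_power norm_divide p[symmetric]
      by (intro power_le_one) auto
    moreover have "norm (g x) < \<delta>" if "x \<in> S - U" for x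
    proof -
      have "norm (g x) = (norm (f x) / norm (f p)) ^ k"
        using that by (simp add: g norm_power norm_divide)
      also have "\<dots> \<le> q ^ k"
        unfolding q_def using ymax[OF that] by (intro power_mono divide_right_mono) auto
      finally show ?thesis
        using k by simp
    qed
    ultimately show thesis
      using that pU by blast
  qed
qed

text \<open>
  For \<open>Re z \<ge> \<eta>\<close> the clipped and rescaled value \<open>t\<close> satisfies \<open>Re z - t = \<eta> * (1 - t)\<close>, and below
  the threshold both \<open>Re z\<close> and \<open>t = 0\<close> are in \<open>[- \<eta>, \<eta>]\<close>; the imaginary part costs another \<open>\<eta>\<close>.
\<close>

lemma clip_close:
  fixes z :: complex and \<eta> :: real
  assumes "0 < \<eta>" "\<eta> < 1" "- \<eta> \<le> Re z" "Re z \<le> 1" "\<bar>Im z\<bar> \<le> \<eta>"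
  shows "dist (complex_of_real (max 0 ((Re z - \<eta>) / (1 - \<eta>)))) z \<le> 2 * \<eta>"
proof -
  define t where "t = max 0 ((Re z - \<eta>) / (1 - \<eta>))"
  have "\<bar>t - Re z\<bar> \<le> \<eta>"
  proof (cases "Re z \<le> \<eta>")
    case True
    then have "t = 0"
      using assms by (simp add: t_def divide_nonpos_pos max_absorb1)
    then show ?thesis
      using True assms by simp
  next
    case False
    then have "t = (Re z - \<eta>) / (1 - \<eta>)"
      using assms by (simp add: t_def max_def)
    then have "t * (1 - \<eta>) = Re z - \<eta>"
      using assms by simp
    then have *: "Re z - t = \<eta> * (1 - t)"
      by (simp add: algebra_simps)
    have "0 \<le> t" "t \<le> 1"
      using assms False \<open>t = (Re z - \<eta>) / (1 - \<eta>)\<close> by (auto simp: t_def)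
    then have "0 \<le> \<eta> * (1 - t)" "\<eta> * (1 - t) \<le> \<eta>"
      using assms by (auto simp: mult_left_le)
    then show ?thesis
      using * by linarith
  qed
  moreover have "norm (of_real t - z) \<le> \<bar>Re (of_real t - z)\<bar> + \<bar>Im (of_real t - z)\<bar>"
    by (rule cmod_le)
  ultimately show ?thesis
    using assms by (simp add: dist_norm t_def)
qed

text \<open>
  The peaking function is composed with the thin polynomial \<open>P\<close>. Nonnegative coefficients with
  sum \<open>1\<close> and vanishing constant term give \<open>norm (P z) \<le> norm z\<close> on the disc; so composition
  preserves both the bound \<open>1\<close> on \<open>S\<close> and the smallness off \<open>U\<close>.
\<close>

lemma uniform_algebra_thin_peaking:
  assumes X: "compact_space X" and A: "uniform_algebra X A" and S: "is_Shilov_boundary X A S"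
    and U: "openin (subtopology X S) U" "U \<noteq> {}" and \<eta>: "\<eta> > 0"
  obtains g p where "g \<in> A" "p \<in> U" "g p = 1"
    "\<And>x. x \<in> S \<Longrightarrow> Re (g x) \<le> 1" "\<And>x. x \<in> S \<Longrightarrow> - \<eta> \<le> Re (g x)"
    "\<And>x. x \<in> S \<Longrightarrow> \<bar>Im (g x)\<bar> \<le> \<eta>" "\<And>x. x \<in> S - U \<Longrightarrow> Re (g x) < \<eta>"
proof -
  obtain N a where a: "a 0 = 0" "\<And>n. a n \<ge> (0::real)" "(\<Sum>n<N. a n) = 1"
    and Re: "\<And>z. norm z \<le> 1 \<Longrightarrow> Re (\<Sum>n<N. complex_of_real (a n) * z ^ n) \<ge> - \<eta>"
    and Im: "\<And>z. norm z \<le> 1 \<Longrightarrow> \<bar>Im (\<Sum>n<N. complex_of_real (a n) * z ^ n)\<bar> \<le> \<eta>"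
    using thin_polynomial[OF \<eta>] by metis
  obtain f p where f: "f \<in> A" "p \<in> U" "f p = 1"
    and f1: "\<And>x. x \<in> S \<Longrightarrow> norm (f x) \<le> 1" and f\<eta>: "\<And>x. x \<in> S - U \<Longrightarrow> norm (f x) < \<eta>"
    using Shilov_boundary_peaking[OF X A S U \<eta>] by metis
  have sub: "S \<subseteq> topspace X"
    using S closedin_subset by (auto simp: is_Shilov_boundary_def)
  have "p \<in> S"
    using openin_subset[OF U(1)] f(2) by auto
  define P where "P z = (\<Sum>n<N. complex_of_real (a n) * z ^ n)" for z
  have P_le: "norm (P z) \<le> norm z" if "norm z \<le> 1" for z
  proof -
    have "norm (of_real (a n) * z ^ n) \<le> a n * norm z" for n
    proof (cases n)
      case 0
      then show ?thesis by (simp add: a(1))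
    next
      case (Suc m)
      have "norm z ^ Suc m \<le> norm z"
        using that by (simp add: mult_left_le power_le_one)
      then show ?thesis
        using a(2)[of n] unfolding Suc by (simp add: norm_mult norm_power mult_left_mono del: power_Suc)
    qed
    then have "norm (P z) \<le> (\<Sum>n<N. a n * norm z)"
      unfolding P_def by (intro sum_norm_le)
    also have "\<dots> = norm z"
      using a(3) by (simp flip: sum_distrib_right)
    finally show ?thesis .
  qed
  have P1: "P 1 = 1"
    using a(3) by (simp add: P_def flip: of_real_sum)
  define g where "g = (\<lambda>x\<in>topspace X. P (f x))"
  have gx: "g x = P (f x)" if "x \<in> S" for x
    using that sub by (auto simp: g_def)
  show thesis
  proof
    show "g \<in> A"
      unfolding g_def P_def using A f(1) by (rule uniform_algebra_polynomial)
    show "p \<in> U" by fact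
    show "g p = 1"
      using \<open>p \<in> S\<close> f(3) P1 by (simp add: gx)
    fix x assume x: "x \<in> S"
    show "Re (g x) \<le> 1"
      using P_le[OF f1[OF x]] f1[OF x] complex_Re_le_cmod[of "P (f x)"] by (simp add: gx[OF x])
    show "- \<eta> \<le> Re (g x)" "\<bar>Im (g x)\<bar> \<le> \<eta>"
      using Re[OF f1[OF x]] Im[OF f1[OF x]] by (simp_all add: gx[OF x] P_def)
  next
    fix x assume x: "x \<in> S - U"
    then have "x \<in> S" by simp
    then show "Re (g x) < \<eta>"
      using P_le[OF f1[of x]] f\<eta>[OF x] complex_Re_le_cmod[of "P (f x)"] by (simp add: gx)
  qed
qed

theorem proposition2p2:
  fixes X :: "'a topology" and A :: "('a \<Rightarrow> complex) set" and S :: "'a set"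
  assumes "compact_space X" and "Hausdorff_space X"
    and "uniform_algebra X A"
    and "is_Shilov_boundary X A S"
  shows "C_rich (subtopology X S) ((\<lambda>f. restrict f S) ` A)"
proof -
  let ?K = "subtopology X S" and ?E = "(\<lambda>f. restrict f S) ` A"
  have clS: "closedin X S" and bd: "boundary_for X A S"
    using assms by (auto simp: is_Shilov_boundary_def)
  have topK: "topspace ?K = S"
    using closedin_subset[OF clS] by auto
  have K: "compact_space ?K"
    using assms(1) clS closedin_compact_space compact_space_subtopology by blast
  have "\<exists>h :: 'a \<Rightarrow> real. h \<in> mspace (C_space ?K) \<and> (\<forall>x\<in>topspace ?K. h x \<ge> 0) \<and>
        sup_norm ?K h = 1 \<and> ?K closure_of {x\<in>topspace ?K. h x \<noteq> 0} \<subseteq> U \<and>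
        (INF g\<in>?E. mdist (C_space ?K) (\<lambda>x\<in>topspace ?K. of_real (h x)) g) < \<epsilon>"
    if U: "openin ?K U" "U \<noteq> {}" and "\<epsilon> > 0" for U and \<epsilon> :: real
  proof -
    define \<eta> where "\<eta> = min (\<epsilon> / 3) (1 / 2)"
    have \<eta>: "0 < \<eta>" "\<eta> < 1" "2 * \<eta> < \<epsilon>"
      using \<open>\<epsilon> > 0\<close> by (auto simp: \<eta>_def min_def)
    obtain g p where gA: "g \<in> A" and p: "p \<in> U" "g p = 1"
      and g_le: "\<And>x. x \<in> S \<Longrightarrow> Re (g x) \<le> 1" and g_ge: "\<And>x. x \<in> S \<Longrightarrow> - \<eta> \<le> Re (g x)"
      and g_Im: "\<And>x. x \<in> S \<Longrightarrow> \<bar>Im (g x)\<bar> \<le> \<eta>" and g_off: "\<And>x. x \<in> S - U \<Longrightarrow> Re (g x) < \<eta>"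
      using uniform_algebra_thin_peaking[OF assms(1,3,4) U \<eta>(1)] by metis
    have "p \<in> S"
      using openin_subset[OF U(1)] p(1) by auto
    define h where "h = (\<lambda>x\<in>S. max 0 ((Re (g x) - \<eta>) / (1 - \<eta>)))"
    have "continuous_map ?K euclidean g"
      using uniform_algebra_continuous[OF assms(1,3) gA] by (rule continuous_map_from_subtopology)
    then have Re_g: "continuous_map ?K euclideanreal (\<lambda>x. Re (g x))"
      using continuous_map_compose[of ?K euclidean g euclideanreal Re]
      by (simp add: o_def continuous_on_Re)
    have "continuous_map ?K euclideanreal (\<lambda>x. max 0 ((Re (g x) - \<eta>) / (1 - \<eta>)))"
      using \<eta> Re_g by (intro continuous_intros) auto
    then have "continuous_map ?K euclideanreal h"
      by (rule continuous_map_eq) (simp add: h_def topK)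
    then have hC: "h \<in> mspace (C_space ?K)"
      unfolding mspace_C_space[OF K] topK by (simp add: h_def)
    moreover have h0: "\<forall>x\<in>topspace ?K. h x \<ge> 0"
      by (simp add: h_def topK)
    moreover have "sup_norm ?K h = 1"
      unfolding sup_norm_def topK
    proof (rule cSup_eq_maximum)
      have "h p = 1"
        using \<open>p \<in> S\<close> p \<eta> by (simp add: h_def)
      then show "1 \<in> (\<lambda>x. norm (h x)) ` S"
        using \<open>p \<in> S\<close> by (intro image_eqI[of _ _ p]) auto
      show "y \<le> 1" if "y \<in> (\<lambda>x. norm (h x)) ` S" for y
        using that g_le \<eta> by (auto simp: h_def divide_le_eq_1)
    qed
    moreover have "?K closure_of {x\<in>topspace ?K. h x \<noteq> 0} \<subseteq> U"
    proof -
      have "closedin ?K {x \<in> topspace ?K. Re (g x) \<in> {\<eta>..}}"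
        using Re_g by (rule closedin_continuous_map_preimage) simp
      moreover have "{x\<in>topspace ?K. h x \<noteq> 0} \<subseteq> {x \<in> topspace ?K. Re (g x) \<in> {\<eta>..}}"
        using \<eta> by (auto simp: h_def topK max_def zero_le_divide_iff split: if_splits)
      ultimately have "?K closure_of {x\<in>topspace ?K. h x \<noteq> 0} \<subseteq> {x \<in> topspace ?K. Re (g x) \<in> {\<eta>..}}"
        by (simp add: closure_of_minimal)
      then show ?thesis
        using g_off by (fastforce simp: topK)
    qed
    moreover have "(INF g\<in>?E. mdist (C_space ?K) (\<lambda>x\<in>topspace ?K. of_real (h x)) g) < \<epsilon>"
    proof -
      let ?d = "mdist (C_space ?K) (\<lambda>x\<in>topspace ?K. complex_of_real (h x))"
      have "bdd_below (?d ` ?E)"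
        by (rule bdd_belowI[of _ 0]) auto
      then have "(INF g\<in>?E. ?d g) \<le> ?d (restrict g S)"
        using gA by (intro cINF_lower) auto
      also have "\<dots> \<le> 2 * \<eta>"
        using \<eta> clip_close[OF \<eta>(1,2) g_ge g_le g_Im] 
        by (intro mdist_cfunspace_le) (auto simp: topK h_def)
      finally show ?thesis
        using \<eta> by simp
    qed
    ultimately show ?thesis by blast
  qed
  moreover have "closed_linear_subspace ?K ?E"
    using assms(1,3) clS bd by (intro closed_linear_subspace_restrict) (auto simp: uniform_algebra_def)
  moreover have "Hausdorff_space ?K"
    using assms(2) by (rule Hausdorff_space_subtopology)
  ultimately show ?thesis
    unfolding C_rich_def using K by blast
qed

end
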